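(* Let $(A,\to,\rightsquigarrow,0,1)$ be a bounded commutative pseudo BE-algebra and let $\sigma:A\to A$ be a map satisfying, for all $x,y\in A$: (E1) $x\le\sigma x$; (E2) $(\sigma(x^{-}))^{\sim}=(\sigma(x^{\sim}))^{-}$; (E3) $\sigma(x\odot(\sigma y)^{\sim})=\sigma x\odot(\sigma y)^{\sim}$ and $\sigma((\sigma x)^{-}\odot y)=(\sigma x)^{-}\odot\sigma y$; (E4) $\sigma(x\odot\sigma y)=\sigma(\sigma x\odot y)=\sigma x\odot\sigma y$; (E5) $\sigma((x^{-}\odot x^{-})^{\sim})=((\sigma x)^{-}\odot(\sigma x)^{-})^{\sim}$ and $\sigma((x^{\sim}\odot x^{\sim})^{-})=((\sigma x)^{\sim}\odot(\sigma x)^{\sim})^{-}$; (E6) $\sigma(x\odot x)=\sigma x\odot\sigma x$. Then $\exists:=\sigma$ is an existential quantifier on the corresponding pseudo MV-algebra $(A,\odot,\oplus,{}^{-},{}^{\sim},0,1)$; that is, for all $x,y\in A$: $x\le\exists x$; $\exists(x\vee y)=\exists x\vee\exists y$; $\exists((\exists x)^{-})=(\exists x)^{-}$ and $\exists((\exists x)^{\sim})=(\exists x)^{\sim}$; $\exists(\exists x\odot\exists y)=\exists x\odot\exists y$; $\exists(x\odot x)=\exists x\odot\exists x$; $\exists(x\oplus x)=\exists x\oplus\exists x$.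
   Context: A pseudo BE-algebra is an algebra $(A,\to,\rightsquigarrow,1)$ of type $(2,2,0)$ such that for all $x,y,z\in A$: $x\to x=x\rightsquigarrow x=1$; $x\to 1=x\rightsquigarrow 1=1$; $1\to x=1\rightsquigarrow x=x$; $x\to(y\rightsquigarrow z)=y\rightsquigarrow(x\to z)$; and $x\to y=1$ iff $x\rightsquigarrow y=1$. One writes $x\le y$ iff $x\to y=1$ (equivalently $x\rightsquigarrow y=1$). It is commutative if $(x\to y)\rightsquigarrow y=(y\to x)\rightsquigarrow x$ and $(x\rightsquigarrow y)\to y=(y\rightsquigarrow x)\to x$ for all $x,y$. It is bounded if it has an element $0$ with $0\le x$ for all $x$; then $x^{-}=x\to 0$ and $x^{\sim}=x\rightsquigarrow 0$. In a bounded commutative pseudo BE-algebra, $x^{-\sim}=x^{\sim-}=x$ and $(A,\le)$ is a lattice with $x\vee y=(x\to y)\rightsquigarrow y=(x\rightsquigarrow y)\to y$ and $x\wedge y=(x^{-}\vee y^{-})^{\sim}=(x^{\sim}\vee y^{\sim})^{-}$. One sets $x\oplus y=y^{\sim}\to x=x^{-}\rightsquigarrow y$ and $x\odot y=(x\to y^{-})^{\sim}=(y\rightsquigarrow x^{\sim})^{-}$. The corresponding pseudo MV-algebra of $A$ is $(A,\odot,\oplus,{}^{-},{}^{\sim},0,1)$ with these operations, with the lattice order $\le$ above. *)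

theory Defs
  imports Main
begin

class pseudo_be_algebra = one +
  fixes imp :: "'a \<Rightarrow> 'a \<Rightarrow> 'a"  (infixr "\<rightarrow>" 60)
    and imp2 :: "'a \<Rightarrow> 'a \<Rightarrow> 'a"  (infixr "\<leadsto>" 60)
  assumes imp_self: "x \<rightarrow> x = 1" and imp2_self: "x \<leadsto> x = 1"
    and imp_one: "x \<rightarrow> 1 = 1" and imp2_one: "x \<leadsto> 1 = 1"
    and one_imp: "1 \<rightarrow> x = x" and one_imp2: "1 \<leadsto> x = x"
    and exchange: "x \<rightarrow> (y \<leadsto> z) = y \<leadsto> (x \<rightarrow> z)"
    and imp_eq_one_iff: "x \<rightarrow> y = 1 \<longleftrightarrow> x \<leadsto> y = 1"
begin

definition le :: "'a \<Rightarrow> 'a \<Rightarrow> bool"  (infix "\<preceq>" 50)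
  where "x \<preceq> y \<longleftrightarrow> x \<rightarrow> y = 1"

end

class bounded_commutative_pseudo_be_algebra = pseudo_be_algebra + zero +
  assumes commute: "(x \<rightarrow> y) \<leadsto> y = (y \<rightarrow> x) \<leadsto> x"
    and commute2: "(x \<leadsto> y) \<rightarrow> y = (y \<leadsto> x) \<rightarrow> x"
    and zero_least: "0 \<preceq> x"
begin

definition neg :: "'a \<Rightarrow> 'a"  ("_\<^sup>-" [1000] 999)
  where "x\<^sup>- = x \<rightarrow> 0"

definition neg2 :: "'a \<Rightarrow> 'a"  ("_\<^sup>\<sim>" [1000] 999)
  where "x\<^sup>\<sim> = x \<leadsto> 0"

text \<open>The other customary formulas for the next three operations are proved below, as is
  the fact that the first operation gives suprema with respect to the order.\<close>

definition join :: "'a \<Rightarrow> 'a \<Rightarrow> 'a"  (infixl "\<squnion>" 65)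
  where "x \<squnion> y = (x \<rightarrow> y) \<leadsto> y"

definition oplus :: "'a \<Rightarrow> 'a \<Rightarrow> 'a"  (infixl "\<oplus>" 65)
  where "x \<oplus> y = y\<^sup>\<sim> \<rightarrow> x"

definition odot :: "'a \<Rightarrow> 'a \<Rightarrow> 'a"  (infixl "\<odot>" 70)
  where "x \<odot> y = (x \<rightarrow> y\<^sup>-)\<^sup>\<sim>"

definition existential_quantifier :: "('a \<Rightarrow> 'a) \<Rightarrow> bool"
  where "existential_quantifier E \<longleftrightarrow>
    (\<forall>x. x \<preceq> E x) \<and>
    (\<forall>x y. E (x \<squnion> y) = E x \<squnion> E y) \<and>
    (\<forall>x. E ((E x)\<^sup>-) = (E x)\<^sup>- \<and> E ((E x)\<^sup>\<sim>) = (E x)\<^sup>\<sim>) \<and>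
    (\<forall>x y. E (E x \<odot> E y) = E x \<odot> E y) \<and>
    (\<forall>x. E (x \<odot> x) = E x \<odot> E x) \<and>
    (\<forall>x. E (x \<oplus> x) = E x \<oplus> E x)"

lemma le_iff_imp2: "x \<preceq> y \<longleftrightarrow> x \<leadsto> y = 1"
  by (simp add: le_def imp_eq_one_iff)

lemma le_refl: "x \<preceq> x"
  by (simp add: le_def imp_self)

lemma le_antisym: "x \<preceq> y \<Longrightarrow> y \<preceq> x \<Longrightarrow> x = y"
  using commute[of x y] by (simp add: le_def one_imp2)

lemma le_trans: "x \<preceq> y \<Longrightarrow> y \<preceq> z \<Longrightarrow> x \<preceq> z"
  using commute[of y z] exchange[of x "z \<rightarrow> y" y]
  by (simp add: le_def one_imp2 imp2_one)

lemma join_upper1: "x \<preceq> x \<squnion> y"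
  by (simp add: join_def le_def exchange imp2_self)

lemma join_upper2: "y \<preceq> x \<squnion> y"
  by (simp add: join_def le_def exchange imp_self imp2_one)

lemma join_commute: "x \<squnion> y = y \<squnion> x"
  by (simp add: join_def commute)

lemma imp_antimono: "u \<preceq> v \<Longrightarrow> v \<rightarrow> w \<preceq> u \<rightarrow> w"
  by (metis exchange join_def join_upper1 le_def le_iff_imp2 le_trans)

lemma imp2_antimono:
  assumes "u \<preceq> v" shows "v \<leadsto> w \<preceq> u \<leadsto> w"
proof -
  have "v \<preceq> (v \<leadsto> w) \<rightarrow> w"
    by (simp add: le_iff_imp2 exchange[symmetric] imp_self)
  then have "u \<preceq> (v \<leadsto> w) \<rightarrow> w"
    using assms le_trans by blast
  then show ?thesis
    by (simp add: le_iff_imp2 exchange[symmetric]) (simp add: imp_eq_one_iff)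
qed

lemma join_least: "x \<preceq> z \<Longrightarrow> y \<preceq> z \<Longrightarrow> x \<squnion> y \<preceq> z"
  using imp2_antimono[OF imp_antimono, of x z y y] commute[of z y]
  by (simp add: join_def le_def one_imp2)

lemma join_alt: "x \<squnion> y = (x \<leadsto> y) \<rightarrow> y"
proof (rule le_antisym)
  show "x \<squnion> y \<preceq> (x \<leadsto> y) \<rightarrow> y"
    by (rule join_least) (simp_all add: le_iff_imp2 exchange[symmetric] imp_self imp2_self imp_one)
  have "(x \<leadsto> y) \<rightarrow> y \<preceq> (x \<squnion> y \<leadsto> y) \<rightarrow> y"
    by (intro imp_antimono imp2_antimono join_upper1)
  also have "(x \<squnion> y \<leadsto> y) \<rightarrow> y = x \<squnion> y"
    using join_upper2[of y x] by (simp add: commute2[of "x \<squnion> y"] le_iff_imp2 one_imp)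
  finally show "(x \<leadsto> y) \<rightarrow> y \<preceq> x \<squnion> y" .
qed

lemma neg_neg2: "(x\<^sup>-)\<^sup>\<sim> = x"
  using zero_least[of x] by (simp add: neg_def neg2_def commute[of x 0] le_def one_imp2)

lemma neg2_neg: "(x\<^sup>\<sim>)\<^sup>- = x"
  using zero_least[of x] by (simp add: neg_def neg2_def commute2[of x 0] le_iff_imp2 one_imp)

lemma oplus_alt: "x \<oplus> y = x\<^sup>- \<leadsto> y"
proof -
  have "x\<^sup>- \<leadsto> (y\<^sup>\<sim>)\<^sup>- = y\<^sup>\<sim> \<rightarrow> (x\<^sup>-)\<^sup>\<sim>"
    by (simp only: neg_def[of "y\<^sup>\<sim>"] neg2_def[of "x\<^sup>-"] exchange)
  then show ?thesis
    by (simp add: oplus_def neg_neg2 neg2_neg)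
qed

lemma odot_alt: "x \<odot> y = (y \<leadsto> x\<^sup>\<sim>)\<^sup>-"
proof -
  have contra: "z\<^sup>- \<leadsto> y\<^sup>- = y \<rightarrow> z" "z\<^sup>\<sim> \<rightarrow> y\<^sup>\<sim> = y \<leadsto> z" for y z
    by (metis exchange neg2_def neg_def neg_neg2) (metis exchange neg2_def neg_def neg2_neg)
  have swap: "a \<preceq> b \<rightarrow> c \<longleftrightarrow> b \<preceq> a \<leadsto> c" for a b c
    by (metis exchange le_def le_iff_imp2)
  have 1: "x \<odot> y \<preceq> z \<longleftrightarrow> x \<preceq> y \<rightarrow> z" for z
    by (metis contra exchange le_def le_iff_imp2 neg_neg2 odot_def)
  have 2: "(y \<leadsto> x\<^sup>\<sim>)\<^sup>- \<preceq> z \<longleftrightarrow> y \<preceq> x \<leadsto> z" for z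
    by (metis contra exchange le_def le_iff_imp2 neg2_neg)
  show ?thesis
    using 1 2 swap by (meson le_antisym le_refl)
qed

end

end

theory Submission
  imports Defs
begin

text \<open>
  The fixed points of \<open>\<sigma>\<close> are exactly its values, and they form a subalgebra: since (E1) forces
  \<open>\<sigma> 1 = 1\<close>, putting \<open>1\<close> for one of the variables in (E4) and (E3) makes \<open>\<sigma>\<close> idempotent and the
  negations of its values fixed points, and (E3) also gives \<open>\<sigma> 0 = 0\<close>. So the fixed points are closed
  under both negations and under \<open>\<odot>\<close>, hence under \<open>\<rightarrow>\<close>, \<open>\<leadsto>\<close> and \<open>\<squnion>\<close>, which can be written in terms of these (lemmas \<open>imp_eq_neg_odot\<close> and \<open>imp2_eq_neg2_odot\<close>).
  Moreover \<open>\<sigma> x\<close> is the least fixed point above \<open>x\<close>. Indeed \<open>x \<preceq> \<sigma> y\<close> says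
  \<open>x \<odot> (\<sigma> y)\<^sup>\<sim> = 0\<close> (lemma \<open>odot_neg2_eq_zero_iff\<close>); applying \<open>\<sigma>\<close> to this equation
  gives, by (E3) and \<open>\<sigma> 0 = 0\<close>, \<open>\<sigma> x \<odot> (\<sigma> y)\<^sup>\<sim> = 0\<close>, that is, \<open>\<sigma> x \<preceq> \<sigma> y\<close>. So \<open>\<sigma>\<close> is
  a closure operator whose closed elements are closed under joins, and such an operator preserves joins. The condition on
  \<open>x \<oplus> x\<close> is (E5) read through De Morgan's law \<open>oplus_eq_neg2_odot\<close>.
\<close>

context bounded_commutative_pseudo_be_algebra
begin

lemma neg2_one: "1\<^sup>\<sim> = 0"
  by (simp add: neg2_def one_imp2)

lemma neg_zero: "0\<^sup>- = 1"
  by (simp add: neg_def imp_self)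

lemma neg2_eq_zero_iff: "x\<^sup>\<sim> = 0 \<longleftrightarrow> x = 1"
  by (metis neg2_neg neg2_one neg_zero)

lemma one_odot: "1 \<odot> x = x"
  by (simp add: odot_def one_imp neg_neg2)

lemma odot_one: "x \<odot> 1 = x"
  by (simp add: odot_alt one_imp2 neg2_neg)

lemma odot_zero: "x \<odot> 0 = 0"
  by (simp add: odot_def neg_zero imp_one neg2_one)

lemma imp_eq_neg_odot: "x \<rightarrow> y = (x \<odot> y\<^sup>\<sim>)\<^sup>-"
  by (simp add: odot_def neg2_neg)

lemma imp2_eq_neg2_odot: "x \<leadsto> y = (y\<^sup>- \<odot> x)\<^sup>\<sim>"
  by (simp add: odot_alt neg_neg2)

lemma odot_neg2_eq_zero_iff: "x \<odot> y\<^sup>\<sim> = 0 \<longleftrightarrow> x \<preceq> y"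
  by (simp add: odot_def neg2_neg neg2_eq_zero_iff le_def)

lemma oplus_eq_neg2_odot: "x \<oplus> y = (y\<^sup>- \<odot> x\<^sup>-)\<^sup>\<sim>"
  by (simp add: oplus_alt imp2_eq_neg2_odot)

text \<open>The least closed element above a join is the join of the closures: \<open>E x \<squnion> E y\<close> is a
  closed element above \<open>x \<squnion> y\<close>, so it lies above \<open>E (x \<squnion> y)\<close>.\<close>

lemma closure_join:
  assumes ext: "\<And>x. x \<preceq> E x"
    and least: "\<And>x y. x \<preceq> E y \<Longrightarrow> E x \<preceq> E y"
    and closed: "\<And>x y. E (E x \<squnion> E y) = E x \<squnion> E y"
  shows "E (x \<squnion> y) = E x \<squnion> E y"
proof (rule le_antisym)
  have "x \<squnion> y \<preceq> E x \<squnion> E y"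
    by (meson ext join_least join_upper1 join_upper2 le_trans)
  then show "E (x \<squnion> y) \<preceq> E x \<squnion> E y"
    using least[of "x \<squnion> y" "E x \<squnion> E y"] by (simp add: closed)
  show "E x \<squnion> E y \<preceq> E (x \<squnion> y)"
    by (meson ext join_least join_upper1 join_upper2 least le_trans)
qed

end

theorem proposition5p18:
  fixes \<sigma> :: "'a::bounded_commutative_pseudo_be_algebra \<Rightarrow> 'a"
  assumes E1: "\<And>x. x \<preceq> \<sigma> x"
    and E2: "\<And>x. (\<sigma> (x\<^sup>-))\<^sup>\<sim> = (\<sigma> (x\<^sup>\<sim>))\<^sup>-"
    and E3: "\<And>x y. \<sigma> (x \<odot> (\<sigma> y)\<^sup>\<sim>) = \<sigma> x \<odot> (\<sigma> y)\<^sup>\<sim>"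
      "\<And>x y. \<sigma> ((\<sigma> x)\<^sup>- \<odot> y) = (\<sigma> x)\<^sup>- \<odot> \<sigma> y"
    and E4: "\<And>x y. \<sigma> (x \<odot> \<sigma> y) = \<sigma> x \<odot> \<sigma> y"
      "\<And>x y. \<sigma> (\<sigma> x \<odot> y) = \<sigma> x \<odot> \<sigma> y"
    and E5: "\<And>x. \<sigma> ((x\<^sup>- \<odot> x\<^sup>-)\<^sup>\<sim>) = ((\<sigma> x)\<^sup>- \<odot> (\<sigma> x)\<^sup>-)\<^sup>\<sim>"
      "\<And>x. \<sigma> ((x\<^sup>\<sim> \<odot> x\<^sup>\<sim>)\<^sup>-) = ((\<sigma> x)\<^sup>\<sim> \<odot> (\<sigma> x)\<^sup>\<sim>)\<^sup>-"
    and E6: "\<And>x. \<sigma> (x \<odot> x) = \<sigma> x \<odot> \<sigma> x"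
  shows "existential_quantifier \<sigma>"
proof -
  have one: "\<sigma> 1 = 1"
    using E1[of 1] by (simp add: le_def one_imp)
  have zero: "\<sigma> 0 = 0"
    using E3(1)[of 0 1] by (simp add: one neg2_one odot_zero)
  have idem: "\<sigma> (\<sigma> x) = \<sigma> x" for x
    using E4(1)[of 1 x] by (simp add: one one_odot)
  have neg: "\<sigma> ((\<sigma> x)\<^sup>-) = (\<sigma> x)\<^sup>-" for x
    using E3(2)[of x 1] by (simp add: one odot_one)
  have neg2: "\<sigma> ((\<sigma> x)\<^sup>\<sim>) = (\<sigma> x)\<^sup>\<sim>" for x
    using E3(1)[of 1 x] by (simp add: one one_odot)
  have odot: "\<sigma> (\<sigma> x \<odot> \<sigma> y) = \<sigma> x \<odot> \<sigma> y" for x y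
    using E4(1)[of "\<sigma> x" y] by (simp add: idem)
  \<comment> \<open>Phrased for arbitrary fixed points, closure under the implications iterates to the join.\<close>
  have fix_imp: "\<sigma> (a \<rightarrow> b) = a \<rightarrow> b" and fix_imp2: "\<sigma> (a \<leadsto> b) = a \<leadsto> b"
    if "\<sigma> a = a" "\<sigma> b = b" for a b
    unfolding imp_eq_neg_odot imp2_eq_neg2_odot using that by (metis neg neg2 odot)+
  have join: "\<sigma> (\<sigma> x \<squnion> \<sigma> y) = \<sigma> x \<squnion> \<sigma> y" for x y
    by (simp add: join_def fix_imp fix_imp2 idem)
  have least: "\<sigma> x \<preceq> \<sigma> y" if "x \<preceq> \<sigma> y" for x y
    using that E3(1)[of x y] by (simp add: zero flip: odot_neg2_eq_zero_iff)
  have "\<sigma> (x \<squnion> y) = \<sigma> x \<squnion> \<sigma> y" for x y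
    using E1 least join by (rule closure_join)
  moreover have "\<sigma> (x \<oplus> x) = \<sigma> x \<oplus> \<sigma> x" for x
    using E5(1) by (simp add: oplus_eq_neg2_odot)
  ultimately show ?thesis
    by (simp add: existential_quantifier_def E1 E6 neg neg2 odot)
qed

end
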